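(* Let $\varphi\in\Omega$ and $f\in C_c^\infty(\mathbb{R}^2)$. Then, for $x\in\mathbb{R}^2$, $$f(x)=\frac1{4\pi}R^*\big(\widehat{I}^{-1}\widehat{R}_\varphi f\big)(x).$$
   Context: For $\theta\in[0,2\pi]$ write $\omega=\omega(\theta)=(\cos\theta,\sin\theta)$, and let $p\in\mathbb{R}$. One-dimensional Fourier transforms are normalized as $F_1f(s)=\frac1{\sqrt{2\pi}}\int_{-\infty}^\infty f(t)e^{-ist}\,dt$ and $F_1^{-1}f(t)=\frac1{\sqrt{2\pi}}\int_{-\infty}^\infty f(s)e^{ist}\,ds$. A (positive) mollifier is a smooth, nonnegative, compactly supported integrable function $\varphi:\mathbb{R}\to\mathbb{R}$ such that (1) $\int_{-\infty}^\infty\varphi(t)\,dt=1$, and (2) with $\varphi_h(t)=\frac1h\varphi(t/h)$ and $u\ast\varphi_h(x)=\int_{\mathbb{R}}u(y)\varphi_h(x-y)\,dy$, one has $\|u\ast\varphi_h-u\|_{L^\infty(\mathbb{R})}\to0$ as $h\to0$ for bounded uniformly continuous $u$. It is symmetric if $\varphi(t)=g(|t|)$ for some infinitely differentiable $g:\mathbb{R}\to\mathbb{R}$. $\Omega$ is the set of positive symmetric mollifiers $\varphi$ such that $F_1(\varphi)(s)>0$ for all $s\in\mathbb{R}$. For $\varphi\in\Omega$ and $f\in L^1(\mathbb{R}^2)$ the modified Radon transform is $\widehat{R}_\varphi f(\theta,p)=\int_{\mathbb{R}^2}\chi(x;\theta,p)f(x)\,dx$ with $\chi(x;\theta,p)=(\delta\ast\varphi)(\langle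 x,\omega\rangle-p)$, $\delta$ the delta function; that is, $\chi(x;\theta,p)=\varphi(\langle x,\omega\rangle-p)$. The dual Radon transform of $g$ on $[0,2\pi]\times\mathbb{R}$ is $R^*g(x)=\int_0^{2\pi}g(\theta,\langle x,\omega(\theta)\rangle)\,d\theta$. The modified Riesz potential (depending on $\varphi\in\Omega$) is the operator $$\widehat{I}^{-1}g(\theta,t)=\frac1{\sqrt{2\pi}}F_1^{-1}\left(|s|\,\frac{F_1(g(\theta,\cdot))(s)}{F_1(\varphi)(s)}\right)(t),$$ where $F_1^{-1}$ acts on the variable $s$. *)

theory Defs
  imports "HOL-Probability.Essential_Supremum"
begin

section \<open>Smooth and compactly supported functions\<close>

text \<open>The class \<open>C\<^sup>k\<close> on a whole normed space, by recursion on directional derivatives.\<close>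

primrec C_diff :: "nat \<Rightarrow> ('a::real_normed_vector \<Rightarrow> 'b::real_normed_vector) \<Rightarrow> bool" where
  "C_diff 0 f \<longleftrightarrow> continuous_on UNIV f"
| "C_diff (Suc k) f \<longleftrightarrow>
     (\<forall>x. f differentiable (at x)) \<and> (\<forall>v. C_diff k (\<lambda>x. frechet_derivative f (at x) v))"

definition smooth :: "('a::real_normed_vector \<Rightarrow> 'b::real_normed_vector) \<Rightarrow> bool" where
  "smooth f \<longleftrightarrow> (\<forall>k. C_diff k f)"

definition compactly_supported :: "('a::topological_space \<Rightarrow> 'b::zero) \<Rightarrow> bool" where
  "compactly_supported f \<longleftrightarrow> compact (closure {x. f x \<noteq> 0})"

section \<open>One-dimensional Fourier transform\<close>

definition fourier1 :: "(real \<Rightarrow> complex) \<Rightarrow> real \<Rightarrow> complex" where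
  "fourier1 f s = 1 / sqrt (2 * pi) * (LINT t|lborel. f t * exp (- \<i> * s * t))"

definition inv_fourier1 :: "(real \<Rightarrow> complex) \<Rightarrow> real \<Rightarrow> complex" where
  "inv_fourier1 f t = 1 / sqrt (2 * pi) * (LINT s|lborel. f s * exp (\<i> * s * t))"

section \<open>Mollifiers\<close>

definition mollifier_scale :: "(real \<Rightarrow> real) \<Rightarrow> real \<Rightarrow> real \<Rightarrow> real" where
  "mollifier_scale \<phi> h t = 1 / h * \<phi> (t / h)"

definition convolve :: "(real \<Rightarrow> real) \<Rightarrow> (real \<Rightarrow> real) \<Rightarrow> real \<Rightarrow> real" where
  "convolve u v x = (LINT y|lborel. u y * v (x - y))"

definition Linf_norm :: "(real \<Rightarrow> real) \<Rightarrow> ennreal" where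
  "Linf_norm u = esssup lborel (\<lambda>x. ennreal \<bar>u x\<bar>)"

definition positive_mollifier :: "(real \<Rightarrow> real) \<Rightarrow> bool" where
  "positive_mollifier \<phi> \<longleftrightarrow>
     smooth \<phi> \<and> (\<forall>t. 0 \<le> \<phi> t) \<and> compactly_supported \<phi> \<and> integrable lborel \<phi> \<and>
     (LINT t|lborel. \<phi> t) = 1 \<and>
     (\<forall>u. bounded (range u) \<and> uniformly_continuous_on UNIV u \<longrightarrow>
        ((\<lambda>h. Linf_norm (\<lambda>x. convolve u (mollifier_scale \<phi> h) x - u x)) \<longlongrightarrow> 0) (at_right 0))"

definition symmetric_mollifier :: "(real \<Rightarrow> real) \<Rightarrow> bool" where
  "symmetric_mollifier \<phi> \<longleftrightarrow>
     positive_mollifier \<phi> \<and> (\<exists>g :: real \<Rightarrow> real. smooth g \<and> (\<forall>t. \<phi> t = g \<bar>t\<bar>))"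

text \<open>Positivity of the complex number \<open>F\<^sub>1(\<phi>)(s)\<close> means that it is real and positive.\<close>

definition Omega :: "(real \<Rightarrow> real) set" where
  "Omega = {\<phi>. symmetric_mollifier \<phi> \<and>
     (\<forall>s. fourier1 (\<lambda>t. complex_of_real (\<phi> t)) s \<in> \<real> \<and>
          Re (fourier1 (\<lambda>t. complex_of_real (\<phi> t)) s) > 0)}"

section \<open>Modified Radon transform, dual transform and modified Riesz potential\<close>

definition omega :: "real \<Rightarrow> real ^ 2" where
  "omega \<theta> = vector [cos \<theta>, sin \<theta>]"

text \<open>The kernel is \<open>(\<delta> \<star> \<phi>)(\<langle>x, \<omega>\<rangle> - p)\<close> for the Dirac delta \<open>\<delta>\<close>, and \<open>\<delta> \<star> \<phi> = \<phi>\<close>.\<close>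

definition radon_kernel :: "(real \<Rightarrow> real) \<Rightarrow> real ^ 2 \<Rightarrow> real \<Rightarrow> real \<Rightarrow> real" where
  "radon_kernel \<phi> x \<theta> p = \<phi> (x \<bullet> omega \<theta> - p)"

definition modified_radon ::
    "(real \<Rightarrow> real) \<Rightarrow> (real ^ 2 \<Rightarrow> complex) \<Rightarrow> real \<Rightarrow> real \<Rightarrow> complex" where
  "modified_radon \<phi> f \<theta> p = (LINT x|lborel. complex_of_real (radon_kernel \<phi> x \<theta> p) * f x)"

definition dual_radon :: "(real \<Rightarrow> real \<Rightarrow> complex) \<Rightarrow> real ^ 2 \<Rightarrow> complex" where
  "dual_radon g x = (LINT \<theta>:{0..2 * pi}|lborel. g \<theta> (x \<bullet> omega \<theta>))"

definition modified_riesz ::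
    "(real \<Rightarrow> real) \<Rightarrow> (real \<Rightarrow> real \<Rightarrow> complex) \<Rightarrow> real \<Rightarrow> real \<Rightarrow> complex" where
  "modified_riesz \<phi> g \<theta> t =
     1 / sqrt (2 * pi) *
     inv_fourier1 (\<lambda>s. \<bar>s\<bar> * (fourier1 (g \<theta>) s / fourier1 (\<lambda>r. complex_of_real (\<phi> r)) s)) t"

end

theory Submission
  imports
    Defs
    "HOL-Analysis.Lebesgue_Integral_Substitution"
    "HOL-Probability.Characteristic_Functions"
    "HOL-Probability.Sinc_Integral"
begin

text \<open>
The formula is filtered back-projection, that is, Fourier inversion on the plane written in polar
coordinates. Let \<open>F\<close> be the two-dimensional Fourier integral of \<open>f\<close>. For a fixed direction
\<open>\<omega> = omega \<theta>\<close>, the modified Radon transform is the Radon transform of \<open>f\<close> convolved with \<open>\<phi>\<close> in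
the offset \<open>p\<close>. By the slice theorem (\<open>fourier1_modified_radon\<close>) its Fourier transform in \<open>p\<close> is
\<open>F (s \<omega>)\<close> times the transform of \<open>\<phi>\<close> at \<open>s\<close>, which has no zeros. The division in the modified
Riesz potential cancels the factor from \<open>\<phi>\<close>, and the potential at \<open>t\<close> is
\<open>1 / (2 pi)\<close> times the integral of \<open>\<bar>s\<bar> F (s \<omega>) cis (s t)\<close> over \<open>s\<close>.

The dual transform puts \<open>t = x \<bullet> \<omega>\<close> and integrates over \<open>\<theta>\<close>. The weight \<open>\<bar>s\<bar>\<close> is the Jacobian of polar
coordinates with signed radius, which cover the plane twice when \<open>\<theta>\<close> runs through \<open>[0, 2 pi]\<close>
(\<open>integral_polar\<close>). The result is \<open>1 / pi\<close> times the integral of \<open>F \<xi> cis (\<xi> \<bullet> x)\<close> over the plane, and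
Fourier inversion (\<open>fourier_inversion\<close>) evaluates that integral as \<open>(2 pi)\<^sup>2 f x\<close>, which gives
\<open>4 pi f x\<close>.

The inversion theorem needs \<open>F\<close> to be integrable. For smooth \<open>f\<close> with compact support this follows
from decay (\<open>fourier_integral_decay\<close>), because every derivative of \<open>f\<close> multiplies the Fourier
integral by a coordinate of \<open>\<xi>\<close>. The inversion theorem itself is proved by Gaussian regularisation.
Both hold in every Euclidean space; only the polar coordinates are special to the plane.
\<close>

section \<open>Smooth functions with compact support\<close>

lemma compactly_supported_bound:
  fixes f :: "'a::euclidean_space \<Rightarrow> 'b::zero"
  assumes "compactly_supported f"
  obtains R where "\<And>y. norm y > R \<Longrightarrow> f y = 0"
proof -
  have "bounded {x. f x \<noteq> 0}"
    using assms unfolding compactly_supported_def by (meson bounded_subset closure_subset compact_imp_bounded)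
  then obtain R where "\<And>y. f y \<noteq> 0 \<Longrightarrow> norm y \<le> R" by (auto simp: bounded_iff)
  then show ?thesis by (intro that[of R]) force
qed

lemma integrable_continuous_compactly_supported:
  fixes f :: "'a::euclidean_space \<Rightarrow> 'b::{banach, second_countable_topology}"
  assumes "continuous_on UNIV f" "compactly_supported f"
  shows "integrable lborel f"
proof -
  let ?K = "closure {x. f x \<noteq> 0}"
  have "integrable lborel (\<lambda>x. indicator ?K x *\<^sub>R f x)"
    using assms by (intro borel_integrable_compact) (auto simp: compactly_supported_def intro: continuous_on_subset)
  moreover have "indicator ?K x *\<^sub>R f x = f x" for x
    using closure_subset[of "{x. f x \<noteq> 0}"] by (auto split: split_indicator)
  ultimately show ?thesis by simp
qed

lemma bounded_continuous_compactly_supported: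
  fixes f :: "'a::euclidean_space \<Rightarrow> 'b::real_normed_vector"
  assumes "continuous_on UNIV f" "compactly_supported f"
  obtains B where "\<And>y. norm (f y) \<le> B"
proof -
  let ?K = "closure {x. f x \<noteq> 0}"
  have "compact (f ` ?K)"
    using assms unfolding compactly_supported_def
    by (intro compact_continuous_image) (auto intro: continuous_on_subset)
  then have "bounded (f ` ?K)" by (rule compact_imp_bounded)
  then obtain B where B: "\<And>y. y \<in> ?K \<Longrightarrow> norm (f y) \<le> B"
    unfolding bounded_iff by blast
  have "norm (f y) \<le> max B 0" for y
    using B[of y] closure_subset[of "{x. f x \<noteq> 0}"] by (cases "f y = 0") force+
  then show ?thesis by (rule that)
qed

lemma smooth_continuous: "smooth f \<Longrightarrow> continuous_on UNIV f"
  unfolding smooth_def by (drule spec[of _ 0]) simp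

lemma smooth_differentiable: "smooth f \<Longrightarrow> f differentiable (at x)"
  unfolding smooth_def by (drule spec[of _ 1]) simp

lemma smooth_directional_derivative:
  "smooth f \<Longrightarrow> smooth (\<lambda>x. frechet_derivative f (at x) v)"
  unfolding smooth_def
proof
  fix k assume "\<forall>k. C_diff k f"
  then have "C_diff (Suc k) f" by blast
  then show "C_diff k (\<lambda>x. frechet_derivative f (at x) v)" by simp
qed

lemma compactly_supported_directional_derivative:
  fixes f :: "'a::euclidean_space \<Rightarrow> 'b::real_normed_vector"
  assumes "compactly_supported f"
  shows "compactly_supported (\<lambda>x. frechet_derivative f (at x) v)"
proof -
  let ?K = "closure {x. f x \<noteq> 0}"
  have "frechet_derivative f (at x) v = 0" if x: "x \<notin> ?K" for x
  proof -
    have "eventually (\<lambda>y. y \<in> - ?K) (nhds x)"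
      using x by (intro eventually_nhds_in_open) auto
    then have ev: "eventually (\<lambda>y. 0 = f y) (nhds x)"
      by (rule eventually_mono) (use closure_subset[of "{x. f x \<noteq> 0}"] in auto)
    have "(f has_derivative (\<lambda>_. 0)) (at x)"
      by (rule has_derivative_transform_eventually[OF has_derivative_const[of 0 "at x"]])
        (use ev eventually_nhds_x_imp_x[OF ev] in \<open>auto simp: eventually_at_filter elim: eventually_mono\<close>)
    then show ?thesis by (simp add: frechet_derivative_at[symmetric])
  qed
  then have "{x. frechet_derivative f (at x) v \<noteq> 0} \<subseteq> ?K" by auto
  then have "closure {x. frechet_derivative f (at x) v \<noteq> 0} \<subseteq> ?K"
    by (simp add: closure_minimal)
  moreover have "compact ?K" using assms by (simp add: compactly_supported_def)
  ultimately show ?thesis unfolding compactly_supported_def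
    by (metis closed_closure compact_Int_closed inf.absorb2)
qed

section \<open>Decay of the Fourier integral\<close>

text \<open>The kernel is written with \<^const>\<open>cis\<close> so that its modulus is visibly 1, and there is no
normalising factor: the powers of \<open>2 * pi\<close> are all collected in the inversion theorem.\<close>

definition fourier_integral :: "('a::euclidean_space \<Rightarrow> complex) \<Rightarrow> 'a \<Rightarrow> complex" where
  "fourier_integral f \<xi> = (LINT y|lborel. f y * cis (- (y \<bullet> \<xi>)))"

lemma borel_measurable_cis [measurable]: "cis \<in> borel_measurable borel"
  by (intro borel_measurable_continuous_onI continuous_intros)

lemma integrable_mult_cis:
  assumes "integrable M f" "g \<in> borel_measurable M"
  shows "integrable M (\<lambda>y. f y * cis (g y))"
  by (rule Bochner_Integration.integrable_bound[OF assms(1)]) (use assms in \<open>auto simp: norm_mult\<close>)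

lemma norm_fourier_integral_le:
  "norm (fourier_integral f \<xi>) \<le> (LINT y|lborel. norm (f y))"
  unfolding fourier_integral_def
  by (rule order_trans[OF integral_norm_bound]) (simp add: norm_mult)

lemma fourier_integral_translate:
  fixes f :: "'a::euclidean_space \<Rightarrow> complex"
  assumes [measurable]: "f \<in> borel_measurable borel"
  shows "(LINT y|lborel. f (y + w) * cis (- (y \<bullet> \<xi>))) = cis (w \<bullet> \<xi>) * fourier_integral f \<xi>"
proof -
  have "fourier_integral f \<xi> = (LINT y|distr lborel borel ((+) w). f y * cis (- (y \<bullet> \<xi>)))"
    by (simp add: fourier_integral_def lborel_distr_plus)
  also have "\<dots> = (LINT y|lborel. f (w + y) * cis (- ((w + y) \<bullet> \<xi>)))"
    by (rule integral_distr) auto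
  also have "\<dots> = (LINT y|lborel. (f (y + w) * cis (- (y \<bullet> \<xi>))) * cis (- (w \<bullet> \<xi>)))"
    by (simp add: cis_mult mult.assoc inner_add_left add.commute)
  also have "\<dots> = (LINT y|lborel. f (y + w) * cis (- (y \<bullet> \<xi>))) * cis (- (w \<bullet> \<xi>))"
    by (rule integral_mult_left_zero)
  finally have "fourier_integral f \<xi> = (LINT y|lborel. f (y + w) * cis (- (y \<bullet> \<xi>))) * cis (- (w \<bullet> \<xi>))" .
  then show ?thesis by (simp add: cis_mult mult.left_commute[of "cis (w \<bullet> \<xi>)"] del: integral_mult_left_zero)
qed

text \<open>A derivative is defined by a vanishing remainder; dominated convergence needs the limit of the
quotient itself, which will be the integrand.\<close>

lemma difference_quotient_tendsto:
  assumes "(g has_vector_derivative d) (at 0)"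
  shows "((\<lambda>s. (g s - g 0) /\<^sub>R s) \<longlongrightarrow> d) (at 0)"
proof -
  have "((\<lambda>s. norm (g s - g 0 - s *\<^sub>R d) / norm s) \<longlongrightarrow> 0) (at 0)"
    using assms by (simp add: has_vector_derivative_def has_derivative_iff_norm)
  moreover have "norm (g s - g 0 - s *\<^sub>R d) / norm s = norm ((g s - g 0) /\<^sub>R s - d)" if "s \<noteq> 0" for s
  proof -
    have "(g s - g 0) /\<^sub>R s - d = (g s - g 0 - s *\<^sub>R d) /\<^sub>R s"
      using that by (simp add: algebra_simps)
    then show ?thesis by (simp add: divide_inverse_commute)
  qed
  ultimately have "((\<lambda>s. norm ((g s - g 0) /\<^sub>R s - d)) \<longlongrightarrow> 0) (at 0)"
    by (elim Lim_transform_eventually) (auto simp: eventually_at_filter)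
  then show ?thesis by (simp add: tendsto_norm_zero_iff LIM_zero_iff)
qed

text \<open>Integration by parts without boundary terms: by translation invariance the Fourier integral of the
difference quotient \<open>(f (y + t v) - f y) / t\<close> is \<open>(cis (t (v \<bullet> \<xi>)) - 1) / t\<close> times that of \<open>f\<close>. As
\<open>t\<close> tends to 0, the second factor tends to \<open>\<i> (v \<bullet> \<xi>)\<close>, and dominated convergence identifies the
limit of the first. A dominating function exists because \<open>f\<close> has a bounded derivative and a bounded
support.\<close>

lemma fourier_integral_derivative:
  fixes f :: "'a::euclidean_space \<Rightarrow> complex"
  assumes f: "smooth f" "compactly_supported f"
  shows "fourier_integral (\<lambda>x. frechet_derivative f (at x) v) \<xi> = \<i> * (v \<bullet> \<xi>) * fourier_integral f \<xi>"
proof -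
  let ?D = "\<lambda>x. frechet_derivative f (at x) v"
  define t where "t n = inverse (real (Suc n))" for n
  have t: "0 < t n" "t n \<le> 1" for n by (auto simp: t_def field_simps)
  have t0: "t \<longlonglongrightarrow> 0" unfolding t_def by (rule LIMSEQ_inverse_real_of_nat)
  have t1: "filterlim t (at 0) sequentially"
    using t0 t by (auto simp: filterlim_at intro!: always_eventually less_imp_neq[symmetric])
  have fc: "continuous_on UNIV f" and Dc: "continuous_on UNIV ?D"
    using f smooth_continuous smooth_directional_derivative by blast+
  have [measurable]: "f \<in> borel_measurable borel" "?D \<in> borel_measurable borel"
    using fc Dc by (auto intro: borel_measurable_continuous_onI)
  obtain B where B: "\<And>y. norm (?D y) \<le> B"
    using bounded_continuous_compactly_supported[OF Dc compactly_supported_directional_derivative[OF f(2)]] by blast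
  obtain R where R: "\<And>y. norm y > R \<Longrightarrow> f y = 0"
    using compactly_supported_bound[OF f(2)] by blast
  have der: "((\<lambda>s. f (y + s *\<^sub>R v)) has_derivative (\<lambda>h. h *\<^sub>R ?D (y + s *\<^sub>R v))) (at s)" for y s
  proof -
    have F: "(f has_derivative frechet_derivative f (at x)) (at x)" for x
      using smooth_differentiable[OF f(1)] frechet_derivative_works by blast
    have "((\<lambda>s. f (y + s *\<^sub>R v)) has_derivative (\<lambda>h. frechet_derivative f (at (y + s *\<^sub>R v)) (h *\<^sub>R v))) (at s)"
      by (rule has_derivative_compose[OF _ F]) (auto intro!: derivative_eq_intros)
    then show ?thesis using linear_scale[OF has_derivative_linear[OF F]] by simp
  qed
  let ?q = "\<lambda>n y. (f (y + t n *\<^sub>R v) - f y) /\<^sub>R t n * cis (- (y \<bullet> \<xi>))"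
  \<comment> \<open>For \<open>t n \<le> 1\<close> all quotients vanish outside the support enlarged by \<open>norm v\<close>, and inside it the
    mean value inequality bounds them by \<open>B\<close>.\<close>
  have "(\<lambda>n. LINT y|lborel. ?q n y) \<longlonglongrightarrow> (LINT y|lborel. ?D y * cis (- (y \<bullet> \<xi>)))"
  proof (rule integral_dominated_convergence[where w = "\<lambda>y. B * indicator (cball 0 (R + norm v)) y"])
    show "integrable lborel (\<lambda>y::'a. B * indicator (cball 0 (R + norm v)) y)"
      using emeasure_lborel_cball_finite[of 0 "R + norm v"] by (auto simp: integrable_indicator_iff)
    show "AE y in lborel. (\<lambda>n. ?q n y) \<longlonglongrightarrow> ?D y * cis (- (y \<bullet> \<xi>))"
    proof (rule AE_I2)
      fix y
      have "((\<lambda>s. f (y + s *\<^sub>R v)) has_vector_derivative ?D y) (at 0)"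
        using der[of y 0] by (simp add: has_vector_derivative_def)
      then have "((\<lambda>s. (f (y + s *\<^sub>R v) - f y) /\<^sub>R s) \<longlongrightarrow> ?D y) (at 0)"
        using difference_quotient_tendsto by fastforce
      then show "(\<lambda>n. ?q n y) \<longlonglongrightarrow> ?D y * cis (- (y \<bullet> \<xi>))"
        by (intro tendsto_intros filterlim_compose[OF _ t1, of "\<lambda>s. (f (y + s *\<^sub>R v) - f y) /\<^sub>R s"])
    qed
    show "AE y in lborel. norm (?q n y) \<le> B * indicator (cball 0 (R + norm v)) y" for n
    proof (rule AE_I2)
      fix y
      show "norm (?q n y) \<le> B * indicator (cball 0 (R + norm v)) y"
      proof (cases "y \<in> cball 0 (R + norm v)")
        case True
        have "\<exists>s\<in>{0<..<t n}. norm (f (y + t n *\<^sub>R v) - f (y + 0 *\<^sub>R v)) \<le> norm ((t n - 0) *\<^sub>R ?D (y + s *\<^sub>R v))"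
          using t by (intro mvt_general[of 0 "t n" "\<lambda>s. f (y + s *\<^sub>R v)"] der)
            (auto intro!: continuous_on_compose2[OF fc] continuous_intros)
        then obtain s where "norm (f (y + t n *\<^sub>R v) - f y) \<le> t n * norm (?D (y + s *\<^sub>R v))"
          using t[of n] by auto
        also have "\<dots> \<le> t n * B" using B t[of n] by (intro mult_left_mono) auto
        finally have "norm (f (y + t n *\<^sub>R v) - f y) / t n \<le> B"
          using t[of n] by (simp add: divide_le_eq mult.commute)
        then show ?thesis using True t[of n] by (simp add: norm_mult divide_inverse_commute del: scaleR_right_diff_distrib)
      next
        case False
        then have y: "norm y > R + norm v" by auto
        have "norm y \<le> norm (y + t n *\<^sub>R v) + norm (t n *\<^sub>R v)"
          by (metis add_diff_cancel_right' norm_triangle_ineq4)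
        also have "norm (t n *\<^sub>R v) \<le> norm v" using t[of n] by (auto intro: mult_left_le_one_le)
        finally have "norm (y + t n *\<^sub>R v) > R" using y by simp
        moreover have "norm y > R" using y norm_ge_zero[of v] by linarith
        ultimately show ?thesis using R False by simp
      qed
    qed
  qed auto
  moreover have "(LINT y|lborel. ?q n y) = (cis (t n * (v \<bullet> \<xi>)) - 1) /\<^sub>R t n * fourier_integral f \<xi>" for n
  proof -
    have i: "integrable lborel f"
      by (rule integrable_continuous_compactly_supported[OF fc f(2)])
    have "integrable (distr lborel borel ((+) (t n *\<^sub>R v))) f" using i by (simp add: lborel_distr_plus)
    then have i': "integrable lborel (\<lambda>y. f (y + t n *\<^sub>R v))"
      by (simp add: integrable_distr_eq add.commute)
    have "(LINT y|lborel. ?q n y) = (LINT y|lborel. (f (y + t n *\<^sub>R v) * cis (- (y \<bullet> \<xi>)) - f y * cis (- (y \<bullet> \<xi>))) /\<^sub>R t n)"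
      by (simp add: algebra_simps)
    also have "\<dots> = ((LINT y|lborel. f (y + t n *\<^sub>R v) * cis (- (y \<bullet> \<xi>))) - fourier_integral f \<xi>) /\<^sub>R t n"
      unfolding fourier_integral_def
      by (subst integral_scaleR_right, subst Bochner_Integration.integral_diff)
         (auto intro!: integrable_mult_cis i i')
    also have "\<dots> = (cis (t n * (v \<bullet> \<xi>)) - 1) /\<^sub>R t n * fourier_integral f \<xi>"
      by (subst fourier_integral_translate) (auto simp: algebra_simps)
    finally show ?thesis .
  qed
  moreover have "(\<lambda>n. (cis (t n * (v \<bullet> \<xi>)) - 1) /\<^sub>R t n * fourier_integral f \<xi>)
      \<longlonglongrightarrow> \<i> * (v \<bullet> \<xi>) * fourier_integral f \<xi>"
  proof -
    have "((\<lambda>s. cis (s * (v \<bullet> \<xi>))) has_vector_derivative \<i> * (v \<bullet> \<xi>)) (at 0)"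
      unfolding has_vector_derivative_def
      by (auto intro!: derivative_eq_intros simp: scaleR_conv_of_real mult_ac)
    then have "((\<lambda>s. (cis (s * (v \<bullet> \<xi>)) - 1) /\<^sub>R s) \<longlongrightarrow> \<i> * (v \<bullet> \<xi>)) (at 0)"
      using difference_quotient_tendsto by fastforce
    from filterlim_compose[OF this t1] show ?thesis
      by (rule tendsto_mult[OF _ tendsto_const])
  qed
  ultimately have "(LINT y|lborel. ?D y * cis (- (y \<bullet> \<xi>))) = \<i> * (v \<bullet> \<xi>) * fourier_integral f \<xi>"
    by (simp only: LIMSEQ_unique)
  then show ?thesis by (simp only: fourier_integral_def[of ?D])
qed

text \<open>Each factor \<open>1 + (\<xi> \<bullet> b)\<^sup>2\<close> is paid for by two derivatives in the direction \<open>b\<close>: the modulus of the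
transform, multiplied by \<open>(\<xi> \<bullet> b)\<^sup>2\<close>, is the modulus of the transform of the second derivative, which
is again smooth with compact support. Hence \<open>f\<close> is arbitrary in the induction. For an orthonormal
basis the product of these factors is an integrable weight, which is why the bound has this form
instead of a power of the norm.\<close>

lemma fourier_integral_decay:
  fixes f :: "'a::euclidean_space \<Rightarrow> complex"
  assumes "finite B" "smooth f" "compactly_supported f"
  shows "\<exists>C. \<forall>\<xi>. (\<Prod>b\<in>B. 1 + (\<xi> \<bullet> b)\<^sup>2) * norm (fourier_integral f \<xi>) \<le> C"
  using assms
proof (induction B arbitrary: f)
  case empty
  then show ?case using norm_fourier_integral_le[of f] by auto
next
  case (insert b B)
  let ?D = "\<lambda>g x. frechet_derivative g (at x) b"
  have D: "smooth (?D (?D f))" "compactly_supported (?D (?D f))"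
    using insert.prems by (simp_all add: smooth_directional_derivative compactly_supported_directional_derivative)
  obtain C1 C2 where C: "\<And>\<xi>. (\<Prod>b\<in>B. 1 + (\<xi> \<bullet> b)\<^sup>2) * norm (fourier_integral f \<xi>) \<le> C1"
    "\<And>\<xi>. (\<Prod>b\<in>B. 1 + (\<xi> \<bullet> b)\<^sup>2) * norm (fourier_integral (?D (?D f)) \<xi>) \<le> C2"
    using insert.IH[OF insert.prems] insert.IH[OF D] by blast
  have "fourier_integral (?D (?D f)) \<xi> = - ((\<xi> \<bullet> b)\<^sup>2 * fourier_integral f \<xi>)" for \<xi>
    using insert.prems
    by (simp add: fourier_integral_derivative smooth_directional_derivative
        compactly_supported_directional_derivative inner_commute power2_eq_square)
      (simp add: mult.assoc[symmetric] mult.commute[of _ \<i>] power_mult_distrib flip: power2_eq_square)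
  then have n: "norm (fourier_integral (?D (?D f)) \<xi>) = (\<xi> \<bullet> b)\<^sup>2 * norm (fourier_integral f \<xi>)" for \<xi>
    by (simp add: norm_mult norm_power)
  have "(\<Prod>b\<in>insert b B. 1 + (\<xi> \<bullet> b)\<^sup>2) * norm (fourier_integral f \<xi>) \<le> C1 + C2" for \<xi>
    using C(1)[of \<xi>] C(2)[of \<xi>] insert.hyps unfolding n by (simp add: algebra_simps)
  then show ?case by blast
qed

section \<open>The Fourier transform of the Gaussian\<close>

text \<open>Both the Gaussian and the weight from the decay estimate are products of functions of one coordinate;
this reduces their integrals to one dimension.\<close>

lemma
  fixes h :: "'a::euclidean_space \<Rightarrow> real \<Rightarrow> 'c::{real_normed_field, banach, second_countable_topology}"
  assumes h: "\<And>b. b \<in> Basis \<Longrightarrow> integrable lborel (h b)"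
  shows integrable_lborel_prod: "integrable lborel (\<lambda>x. \<Prod>b\<in>Basis. h b (x \<bullet> b))" (is ?I)
    and integral_lborel_prod:
      "(LINT x|lborel. (\<Prod>b\<in>Basis. h b (x \<bullet> b))) = (\<Prod>b\<in>Basis. (LINT t|lborel. h b t))" (is ?E)
proof -
  interpret product_sigma_finite "\<lambda>_::'a. lborel :: real measure" by standard
  have [measurable]: "h b \<in> borel_measurable borel" if "b \<in> Basis" for b
    using borel_measurable_integrable[OF h[OF that]] by simp
  have [measurable]: "(\<lambda>x. \<Prod>b\<in>Basis. h b (x \<bullet> b)) \<in> borel_measurable borel" by measurable
  have eq: "(\<Prod>b\<in>Basis. h b ((\<Sum>c\<in>Basis. z c *\<^sub>R c) \<bullet> b)) = (\<Prod>b\<in>Basis. h b (z b))" for z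
    by (intro prod.cong) auto
  show ?I
    by (subst lborel_eq, subst integrable_distr_eq) (auto simp: eq intro!: product_integrable_prod h)
  show ?E
    by (subst lborel_eq, subst integral_distr) (auto simp: eq intro!: product_integral_prod h)
qed

definition gaussian :: "'a::real_inner \<Rightarrow> real" where
  "gaussian w = exp (- (w \<bullet> w) / 2)"

lemma borel_measurable_gaussian [measurable]:
  "(gaussian :: 'a::euclidean_space \<Rightarrow> real) \<in> borel_measurable borel"
  unfolding gaussian_def by measurable

lemma gaussian_bounds: "0 \<le> gaussian w" "gaussian w \<le> 1"
  by (auto simp: gaussian_def)

lemma gaussian_eq_prod:
  "gaussian (w::'a::euclidean_space) = (\<Prod>b\<in>Basis. gaussian (w \<bullet> b))"
  unfolding gaussian_def
  by (subst euclidean_inner) (simp add: exp_sum sum_negf[symmetric] sum_divide_distrib)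

lemma gaussian_real: "gaussian (t::real) = sqrt (2 * pi) * std_normal_density t"
  by (simp add: gaussian_def std_normal_density_def power2_eq_square)

lemma integrable_gaussian_real: "integrable lborel (gaussian :: real \<Rightarrow> real)"
  unfolding gaussian_real[abs_def] by (intro integrable_mult_right) (simp add: integrable_normal_density)

text \<open>Up to the factor \<open>sqrt (2 * pi)\<close>, this is the characteristic function of the standard normal
distribution.\<close>

lemma integral_gaussian_cis_real:
  "(LINT t|lborel. of_real (gaussian t) * cis (t * a)) = of_real (sqrt (2 * pi) * gaussian (a::real))"
proof -
  have "char std_normal_distribution a = (LINT t|lborel. std_normal_density t *\<^sub>R cis (t * a))"
    unfolding char_def by (subst integral_density) (auto simp: cis_conv_exp mult_ac)
  then have "(LINT t|lborel. std_normal_density t *\<^sub>R cis (t * a)) = of_real (gaussian a)"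
    by (simp add: char_std_normal_distribution gaussian_def power2_eq_square)
  moreover have "of_real (gaussian t) * cis (t * a) = sqrt (2 * pi) *\<^sub>R (std_normal_density t *\<^sub>R cis (t * a))" for t
    by (simp add: gaussian_real scaleR_conv_of_real)
  ultimately have "(LINT t|lborel. of_real (gaussian t) * cis (t * a)) = sqrt (2 * pi) *\<^sub>R complex_of_real (gaussian a)"
    by (simp only: integral_scaleR_right)
  then show ?thesis by (simp add: scaleR_conv_of_real)
qed

lemma cis_sum: "finite A \<Longrightarrow> cis (\<Sum>i\<in>A. f i) = (\<Prod>i\<in>A. cis (f i))"
  by (induction A rule: finite_induct) (simp_all flip: cis_mult)

lemma integrable_gaussian: "integrable lborel (gaussian :: 'a::euclidean_space \<Rightarrow> real)"
  unfolding gaussian_eq_prod[abs_def, where 'a='a]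
  by (rule integrable_lborel_prod) (rule integrable_gaussian_real)

lemma integral_gaussian_cis:
  fixes w :: "'a::euclidean_space"
  shows "(LINT \<xi>|lborel. of_real (gaussian \<xi>) * cis (\<xi> \<bullet> w)) = of_real (sqrt (2 * pi) ^ DIM('a) * gaussian w)"
proof -
  have "of_real (gaussian \<xi>) * cis (\<xi> \<bullet> w) =
      (\<Prod>b\<in>Basis. of_real (gaussian (\<xi> \<bullet> b)) * cis ((\<xi> \<bullet> b) * (w \<bullet> b)))" for \<xi> :: 'a
    by (subst gaussian_eq_prod, subst euclidean_inner) (simp add: prod.distrib cis_sum)
  then have "(LINT \<xi>|lborel. of_real (gaussian \<xi>) * cis (\<xi> \<bullet> w)) =
      (LINT \<xi>|lborel. (\<Prod>b\<in>Basis. of_real (gaussian (\<xi> \<bullet> b)) * cis ((\<xi> \<bullet> b) * (w \<bullet> b))))"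
    by simp
  also have "\<dots> = (\<Prod>b\<in>Basis. (LINT t|lborel. of_real (gaussian t) * cis (t * (w \<bullet> b))))"
    by (rule integral_lborel_prod) (auto intro!: integrable_mult_cis integrable_of_real integrable_gaussian_real)
  also have "\<dots> = of_real (\<Prod>b\<in>(Basis::'a set). sqrt (2 * pi) * gaussian (w \<bullet> b))"
    by (simp add: integral_gaussian_cis_real)
  also have "\<dots> = of_real (sqrt (2 * pi) ^ DIM('a) * gaussian w)"
    by (simp add: prod.distrib gaussian_eq_prod[of w])
  finally show ?thesis .
qed

section \<open>Fourier inversion\<close>

lemma integral_lborel_affine:
  fixes h :: "'a::euclidean_space \<Rightarrow> 'b::{banach, second_countable_topology}"
  assumes [measurable]: "h \<in> borel_measurable borel" and c: "c \<noteq> 0"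
  shows "(LINT x|lborel. h x) = \<bar>c\<bar> ^ DIM('a) *\<^sub>R (LINT x|lborel. h (t + c *\<^sub>R x))"
  by (subst lborel_affine[OF c, of t]) (simp add: integral_density integral_distr)

lemma integrable_pair_bounded_kernel:
  fixes u :: "'a \<Rightarrow> complex" and v :: "'b \<Rightarrow> complex" and k :: "'a \<Rightarrow> 'b \<Rightarrow> complex"
  assumes "sigma_finite_measure M" "sigma_finite_measure N"
    and u: "integrable M u" and v: "integrable N v"
    and k: "case_prod k \<in> borel_measurable (M \<Otimes>\<^sub>M N)" "\<And>x y. norm (k x y) \<le> 1"
  shows "integrable (M \<Otimes>\<^sub>M N) (\<lambda>(x, y). u x * v y * k x y)"
proof -
  interpret pair_sigma_finite M N using assms(1,2) by (rule pair_sigma_finite.intro)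
  have [measurable]: "u \<in> borel_measurable M" "v \<in> borel_measurable N" "case_prod k \<in> borel_measurable (M \<Otimes>\<^sub>M N)"
    using u v k by auto
  have uv: "integrable (M \<Otimes>\<^sub>M N) (\<lambda>p. u (fst p) * v (snd p))"
    by (rule Fubini_integrable)
      (auto simp: norm_mult intro!: integrable_mult_left integrable_norm u v)
  show ?thesis
  proof (rule Bochner_Integration.integrable_bound[OF uv])
    show "AE p in M \<Otimes>\<^sub>M N. norm (case p of (x, y) \<Rightarrow> u x * v y * k x y) \<le> norm (u (fst p) * v (snd p))"
      using k(2) by (auto simp: norm_mult intro!: AE_I2 mult_left_le)
  qed measurable
qed

lemma borel_measurable_fourier_integral [measurable]:
  fixes f :: "'a::euclidean_space \<Rightarrow> complex"
  assumes [measurable]: "f \<in> borel_measurable borel"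
  shows "fourier_integral f \<in> borel_measurable borel"
  unfolding fourier_integral_def[abs_def] by measurable

text \<open>Gaussian summability. Replacing the constant 1 by \<open>gaussian (\<xi> / N)\<close> makes the double integral over
\<open>\<xi>\<close> and \<open>y\<close> absolutely convergent, so the order of integration can be exchanged. The integral over
\<open>\<xi>\<close> is then the transform of a Gaussian, that is, a Gaussian concentrated at \<open>x\<close> with width \<open>1 / N\<close>,
and after rescaling the integral becomes that of \<open>f (x + w / N)\<close> against a fixed Gaussian. Dominated
convergence on both sides gives the limit: on the left by integrability of the transform, on the
right by continuity and boundedness of \<open>f\<close>.\<close>

theorem fourier_inversion:
  fixes f :: "'a::euclidean_space \<Rightarrow> complex"
  assumes f: "integrable lborel f" "continuous_on UNIV f" "\<And>y. norm (f y) \<le> B"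
    and F: "integrable lborel (fourier_integral f)"
  shows "(LINT \<xi>|lborel. fourier_integral f \<xi> * cis (\<xi> \<bullet> x)) = (2 * pi) ^ DIM('a) * f x"
proof -
  have [measurable]: "f \<in> borel_measurable borel" using borel_measurable_integrable[OF f(1)] by simp
  let ?c = "sqrt (2 * pi) ^ DIM('a)"
  let ?I = "\<lambda>n::nat. LINT \<xi>|lborel. fourier_integral f \<xi> * cis (\<xi> \<bullet> x) * gaussian (\<xi> /\<^sub>R Suc n)"
  have lim0: "(\<lambda>n. w /\<^sub>R real (Suc n)) \<longlonglongrightarrow> 0" for w :: 'a
    using tendsto_scaleR[OF LIMSEQ_inverse_real_of_nat tendsto_const[of w]] by simp
  have cg: "continuous_on UNIV (gaussian :: 'a \<Rightarrow> real)"
    unfolding gaussian_def by (intro continuous_intros) auto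
  have "?I \<longlonglongrightarrow> (LINT \<xi>|lborel. fourier_integral f \<xi> * cis (\<xi> \<bullet> x) * gaussian (0::'a))"
  proof (rule integral_dominated_convergence[where w = "\<lambda>\<xi>. norm (fourier_integral f \<xi>)"])
    show "AE \<xi> in lborel. (\<lambda>n. fourier_integral f \<xi> * cis (\<xi> \<bullet> x) * gaussian (\<xi> /\<^sub>R Suc n))
        \<longlonglongrightarrow> fourier_integral f \<xi> * cis (\<xi> \<bullet> x) * gaussian (0::'a)"
      by (intro AE_I2 tendsto_mult tendsto_const tendsto_of_real continuous_on_tendsto_compose[OF cg lim0]) auto
    show "AE \<xi> in lborel. norm (fourier_integral f \<xi> * cis (\<xi> \<bullet> x) * gaussian (\<xi> /\<^sub>R Suc n))
        \<le> norm (fourier_integral f \<xi>)" for n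
      by (intro AE_I2) (auto simp: norm_mult gaussian_bounds intro!: mult_left_le)
  qed (use F in auto)
  moreover have "?I n = (LINT w|lborel. f (x + w /\<^sub>R Suc n) * (?c * gaussian w))" for n
  proof -
    let ?N = "real (Suc n)"
    have g: "integrable lborel (\<lambda>\<xi>::'a. complex_of_real (gaussian (\<xi> /\<^sub>R ?N)))"
    proof -
      have "integrable lborel (gaussian :: 'a \<Rightarrow> real)" by (rule integrable_gaussian)
      then have "integrable (density (distr lborel borel (\<lambda>x::'a. 0 + inverse ?N *\<^sub>R x)) (\<lambda>_. \<bar>inverse ?N\<bar> ^ DIM('a))) gaussian"
        by (subst lborel_affine[symmetric]) auto
      then show ?thesis
        by (subst (asm) integrable_density) (auto simp: integrable_distr_eq)
    qed
    have k: "integrable (lborel \<Otimes>\<^sub>M lborel) (\<lambda>(\<xi>, y). gaussian (\<xi> /\<^sub>R ?N) * f y * cis (\<xi> \<bullet> (x - y)))"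
    proof (rule integrable_pair_bounded_kernel[OF lborel.sigma_finite_measure_axioms lborel.sigma_finite_measure_axioms g f(1)])
      show "(\<lambda>(\<xi>, y). cis (\<xi> \<bullet> (x - y))) \<in> borel_measurable (lborel \<Otimes>\<^sub>M lborel)" by measurable
    qed simp
    have "?I n = (LINT \<xi>|lborel. LINT y|lborel. gaussian (\<xi> /\<^sub>R ?N) * f y * cis (\<xi> \<bullet> (x - y)))"
    proof (intro Bochner_Integration.integral_cong refl)
      fix \<xi> :: 'a
      have "fourier_integral f \<xi> * cis (\<xi> \<bullet> x) * gaussian (\<xi> /\<^sub>R ?N) =
          (LINT y|lborel. f y * cis (- (y \<bullet> \<xi>)) * (cis (\<xi> \<bullet> x) * gaussian (\<xi> /\<^sub>R ?N)))"
        unfolding fourier_integral_def mult.assoc[of _ "cis (\<xi> \<bullet> x)"]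
        by (rule integral_mult_left_zero[symmetric])
      also have "\<dots> = (LINT y|lborel. gaussian (\<xi> /\<^sub>R ?N) * f y * cis (\<xi> \<bullet> (x - y)))"
      proof (intro Bochner_Integration.integral_cong refl)
        fix y
        have "cis (\<xi> \<bullet> (x - y)) = cis (- (y \<bullet> \<xi>)) * cis (\<xi> \<bullet> x)"
          by (simp add: cis_mult inner_diff_right inner_commute)
        then show "f y * cis (- (y \<bullet> \<xi>)) * (cis (\<xi> \<bullet> x) * gaussian (\<xi> /\<^sub>R ?N)) = gaussian (\<xi> /\<^sub>R ?N) * f y * cis (\<xi> \<bullet> (x - y))"
          by simp
      qed
      finally show "fourier_integral f \<xi> * cis (\<xi> \<bullet> x) * gaussian (\<xi> /\<^sub>R ?N) =
          (LINT y|lborel. gaussian (\<xi> /\<^sub>R ?N) * f y * cis (\<xi> \<bullet> (x - y)))" .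
    qed
    also have "\<dots> = (LINT y|lborel. LINT \<xi>|lborel. gaussian (\<xi> /\<^sub>R ?N) * f y * cis (\<xi> \<bullet> (x - y)))"
      by (rule lborel_pair.Fubini_integral[OF k, symmetric])
    also have "\<dots> = (LINT y|lborel. ?N ^ DIM('a) *\<^sub>R (f y * (?c * gaussian (?N *\<^sub>R (y - x)))))"
    proof (intro Bochner_Integration.integral_cong refl)
      fix y
      have "(LINT \<xi>|lborel. complex_of_real (gaussian (\<xi> /\<^sub>R ?N)) * f y * cis (\<xi> \<bullet> (x - y))) =
          ?N ^ DIM('a) *\<^sub>R (LINT \<xi>|lborel. gaussian (\<xi> :: 'a) * f y * cis (\<xi> \<bullet> (?N *\<^sub>R (x - y))))"
        by (subst integral_lborel_affine[where c = ?N and t = 0]) auto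
      also have "(LINT \<xi>|lborel. gaussian (\<xi> :: 'a) * f y * cis (\<xi> \<bullet> (?N *\<^sub>R (x - y)))) =
          (LINT \<xi>|lborel. f y * (gaussian (\<xi> :: 'a) * cis (\<xi> \<bullet> (?N *\<^sub>R (x - y)))))"
        by (simp add: mult_ac)
      also have "\<dots> = f y * (?c * gaussian (?N *\<^sub>R (x - y)))"
        by (subst integral_mult_right_zero, subst integral_gaussian_cis) simp
      also have "gaussian (?N *\<^sub>R (x - y)) = gaussian (?N *\<^sub>R (y - x))"
        by (simp add: gaussian_def inner_diff_left inner_diff_right algebra_simps)
      finally show "(LINT \<xi>|lborel. complex_of_real (gaussian (\<xi> /\<^sub>R ?N)) * f y * cis (\<xi> \<bullet> (x - y))) =
          ?N ^ DIM('a) *\<^sub>R (f y * (?c * gaussian (?N *\<^sub>R (y - x))))" .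
    qed
    also have "\<dots> = (LINT w|lborel. f (x + w /\<^sub>R ?N) * (?c * gaussian w))"
      by (subst integral_lborel_affine[where c = "inverse ?N" and t = x]) (auto simp flip: power_mult_distrib)
    finally show ?thesis .
  qed
  moreover have "(\<lambda>n. LINT w|lborel. f (x + w /\<^sub>R Suc n) * (?c * gaussian w)) \<longlonglongrightarrow>
      (LINT w|lborel. f (x + 0) * (?c * gaussian (w::'a)))"
  proof (rule integral_dominated_convergence[where w = "\<lambda>w. B * (?c * gaussian w)"])
    show "integrable lborel (\<lambda>w::'a. B * (?c * gaussian w))"
      by (intro integrable_mult_right integrable_gaussian)
    show "AE w in lborel. (\<lambda>n. f (x + w /\<^sub>R Suc n) * (?c * gaussian w)) \<longlonglongrightarrow> f (x + 0) * (?c * gaussian w)"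
      by (intro AE_I2 tendsto_mult tendsto_const continuous_on_tendsto_compose[OF f(2)] tendsto_add lim0) auto
    show "AE w in lborel. norm (f (x + w /\<^sub>R Suc n) * (?c * gaussian w)) \<le> B * (?c * gaussian w)" for n
      using f(3) by (intro AE_I2) (auto simp: norm_mult norm_power gaussian_bounds intro!: mult_right_mono)
  qed auto
  moreover have "(LINT w|lborel. f (x + 0) * (?c * gaussian (w::'a))) = (2 * pi) ^ DIM('a) * f x"
  proof -
    have "(LINT w|lborel. complex_of_real (gaussian (w::'a))) = ?c"
      using integral_gaussian_cis[of "0::'a"] by (simp add: gaussian_def)
    then have "(LINT w|lborel. f (x + 0) * (?c * gaussian (w::'a))) = f x * of_real (?c * ?c)"
      by simp
    also have "?c * ?c = (2 * pi) ^ DIM('a)"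
      by (simp only: power_mult_distrib[symmetric] real_sqrt_mult_self) simp
    finally show ?thesis by (simp only: mult.commute)
  qed
  moreover have "gaussian (0::'a) = 1" by (simp add: gaussian_def)
  ultimately show ?thesis using LIMSEQ_unique by force
qed

lemma integrable_fourier_integral:
  fixes f :: "'a::euclidean_space \<Rightarrow> complex"
  assumes "smooth f" "compactly_supported f"
  shows "integrable lborel (fourier_integral f)"
proof -
  obtain C where C: "\<And>\<xi>::'a. (\<Prod>b\<in>Basis. 1 + (\<xi> \<bullet> b)\<^sup>2) * norm (fourier_integral f \<xi>) \<le> C"
    using fourier_integral_decay[OF finite_Basis assms] by blast
  have [measurable]: "f \<in> borel_measurable borel"
    using assms by (intro borel_measurable_continuous_onI smooth_continuous)
  have "integrable lborel (\<lambda>t::real. inverse (1 + t\<^sup>2))"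
    using integrable_inverse_1_plus_square by (simp add: set_integrable_def einterval_def)
  then have i: "integrable lborel (\<lambda>\<xi>::'a. C * (\<Prod>b\<in>Basis. inverse (1 + (\<xi> \<bullet> b)\<^sup>2)))"
    by (intro integrable_mult_right integrable_lborel_prod)
  show ?thesis
  proof (rule Bochner_Integration.integrable_bound[OF i])
    have "norm (fourier_integral f \<xi>) \<le> C * (\<Prod>b\<in>Basis. inverse (1 + (\<xi> \<bullet> b)\<^sup>2))" for \<xi>
    proof -
      have "0 < (\<Prod>b\<in>Basis. 1 + (\<xi> \<bullet> b)\<^sup>2)" by (intro prod_pos) (simp add: add_pos_nonneg)
      then show ?thesis using C[of \<xi>] by (simp add: inverse_eq_divide prod_dividef pos_le_divide_eq mult.commute)
    qed
    then show "AE \<xi> in lborel. norm (fourier_integral f \<xi>) \<le> norm (C * (\<Prod>b\<in>Basis. inverse (1 + (\<xi> \<bullet> b)\<^sup>2)))"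
      by (intro AE_I2) (metis abs_ge_self order_trans real_norm_def)
  qed measurable
qed

section \<open>Polar coordinates with signed radius\<close>

text \<open>The substitution rule for compact intervals applies on \<open>[- arctan n, arctan n]\<close>, and monotone
convergence exhausts the open interval.\<close>

lemma nn_integral_tan_substitution:
  fixes f :: "real \<Rightarrow> ennreal"
  assumes [measurable]: "f \<in> borel_measurable borel"
  shows "(\<integral>\<^sup>+u. f u \<partial>lborel) =
    (\<integral>\<^sup>+\<theta>. f (tan \<theta>) * ennreal (inverse ((cos \<theta>)\<^sup>2)) * indicator {- (pi / 2)<..<pi / 2} \<theta> \<partial>lborel)"
proof -
  have [measurable]: "tan \<in> borel_measurable (borel :: real measure)"
    unfolding tan_def[abs_def] by measurable
  \<comment> \<open>\<open>Suc n\<close> instead of \<open>n\<close> keeps the intervals nondegenerate, as the substitution rule demands.\<close>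
  define a where "a n = arctan (real (Suc n))" for n
  have a: "0 < a n" "a n < pi / 2" for n using arctan_bounded by (auto simp: a_def)
  have inc: "incseq (\<lambda>n. {- a n..a n})" "incseq (\<lambda>n. {- real (Suc n)..real (Suc n)})"
    by (auto simp: a_def incseq_def arctan_le_iff intro: order_trans)
  have U: "(\<Union>n. {- real (Suc n)..real (Suc n)}) = UNIV"
  proof (intro set_eqI iffI UNIV_I)
    fix u :: real
    obtain n where "\<bar>u\<bar> \<le> real n" using real_arch_simple by blast
    then show "u \<in> (\<Union>n. {- real (Suc n)..real (Suc n)})" by (intro UN_I[of n]) auto
  qed
  have V: "(\<Union>n. {- a n..a n}) = {- (pi / 2)<..<pi / 2}"
  proof (intro set_eqI iffI)
    fix \<theta> assume "\<theta> \<in> (\<Union>n. {- a n..a n})"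
    then obtain n where "- a n \<le> \<theta>" "\<theta> \<le> a n" by auto
    then show "\<theta> \<in> {- (pi / 2)<..<pi / 2}" using a[of n] by auto
  next
    fix \<theta> assume "\<theta> \<in> {- (pi / 2)<..<pi / 2}"
    then have \<theta>: "arctan (tan \<theta>) = \<theta>" by (intro arctan_tan) auto
    obtain n where "\<bar>tan \<theta>\<bar> \<le> real n" using real_arch_simple by blast
    then have "arctan (- real (Suc n)) \<le> arctan (tan \<theta>)" "arctan (tan \<theta>) \<le> arctan (real (Suc n))"
      by (auto simp only: arctan_le_iff)
    then have "- a n \<le> \<theta>" "\<theta> \<le> a n" by (simp_all only: \<theta> a_def arctan_minus)
    then show "\<theta> \<in> (\<Union>n. {- a n..a n})" by (intro UN_I[of n]) auto
  qed
  let ?w = "\<lambda>\<theta>. f (tan \<theta>) * ennreal (inverse ((cos \<theta>)\<^sup>2))"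
  have eq: "(\<integral>\<^sup>+u. f u * indicator {- real (Suc n)..real (Suc n)} u \<partial>lborel) =
      (\<integral>\<^sup>+\<theta>. ?w \<theta> * indicator {- a n..a n} \<theta> \<partial>lborel)" for n
  proof -
    have c: "cos \<theta> \<noteq> 0" if "\<theta> \<in> {- a n..a n}" for \<theta>
      using a[of n] that cos_gt_zero_pi[of \<theta>] by auto
    have "(\<integral>\<^sup>+u. f u * indicator {tan (- a n)..tan (a n)} u \<partial>lborel) =
        (\<integral>\<^sup>+\<theta>. f (tan \<theta>) * ennreal (inverse ((cos \<theta>)\<^sup>2)) * indicator {- a n..a n} \<theta> \<partial>lborel)"
      using a[of n] c by (intro nn_integral_substitution_aux DERIV_tan continuous_intros) auto
    then show ?thesis by (simp add: a_def tan_arctan)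
  qed
  have "(\<integral>\<^sup>+u. f u \<partial>lborel) = emeasure (density lborel f) UNIV"
    by (simp add: emeasure_density)
  also have "\<dots> = (SUP n. emeasure (density lborel f) {- real (Suc n)..real (Suc n)})"
    unfolding U[symmetric] by (rule SUP_emeasure_incseq[symmetric]) (use inc in auto)
  also have "\<dots> = (SUP n. emeasure (density lborel ?w) {- a n..a n})"
    by (intro SUP_cong refl) (subst (1 2) emeasure_density; simp add: eq del: of_nat_Suc)
  also have "\<dots> = emeasure (density lborel ?w) (\<Union>n. {- a n..a n})"
    by (rule SUP_emeasure_incseq) (use inc in auto)
  also have "\<dots> = (\<integral>\<^sup>+\<theta>. ?w \<theta> * indicator {- (pi / 2)<..<pi / 2} \<theta> \<partial>lborel)"
    unfolding V by (subst emeasure_density) auto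
  finally show ?thesis .
qed

text \<open>Polar coordinates are obtained from three one-dimensional substitutions: \<open>b = a u\<close> for fixed \<open>a\<close>
(the line \<open>a = 0\<close> is a null set), then \<open>u = tan \<theta>\<close>, and finally \<open>a = s cos \<theta>\<close> for fixed \<open>\<theta>\<close>. Their
Jacobians \<open>\<bar>a\<bar>\<close>, \<open>1 / (cos \<theta>)\<^sup>2\<close> and \<open>cos \<theta>\<close> multiply to \<open>\<bar>s\<bar>\<close>. Since \<open>s\<close> runs over all reals, the
angles of a half plane already cover the whole plane.\<close>

lemma nn_integral_polar_half_plane:
  fixes G :: "real \<times> real \<Rightarrow> ennreal"
  assumes [measurable]: "G \<in> borel_measurable borel"
  shows "(\<integral>\<^sup>+p. G p \<partial>lborel) = (\<integral>\<^sup>+\<theta>. (\<integral>\<^sup>+s. ennreal \<bar>s\<bar> * G (s * cos \<theta>, s * sin \<theta>) \<partial>lborel) *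
    indicator {- (pi / 2)<..<pi / 2} \<theta> \<partial>lborel)"
proof -
  have "(\<integral>\<^sup>+p. G p \<partial>lborel) = (\<integral>\<^sup>+a. \<integral>\<^sup>+b. G (a, b) \<partial>lborel \<partial>lborel)"
    unfolding lborel_prod[symmetric] by (rule lborel.nn_integral_fst[symmetric]) (simp add: lborel_prod)
  also have "\<dots> = (\<integral>\<^sup>+a. \<integral>\<^sup>+u. ennreal \<bar>a\<bar> * G (a, a * u) \<partial>lborel \<partial>lborel)"
  proof (rule nn_integral_cong_AE)
    show "AE a in lborel. (\<integral>\<^sup>+b. G (a, b) \<partial>lborel) = (\<integral>\<^sup>+u. ennreal \<bar>a\<bar> * G (a, a * u) \<partial>lborel)"
      using AE_lborel_singleton[of "0::real"]
    proof eventually_elim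
      fix a :: real assume "a \<noteq> 0"
      then show "(\<integral>\<^sup>+b. G (a, b) \<partial>lborel) = (\<integral>\<^sup>+u. ennreal \<bar>a\<bar> * G (a, a * u) \<partial>lborel)"
        by (subst nn_integral_real_affine[where c = a and t = 0]) (auto simp: nn_integral_cmult)
    qed
  qed
  also have "\<dots> = (\<integral>\<^sup>+u. \<integral>\<^sup>+a. ennreal \<bar>a\<bar> * G (a, a * u) \<partial>lborel \<partial>lborel)"
    by (rule lborel_pair.Fubini'[symmetric]) measurable
  also have "\<dots> = (\<integral>\<^sup>+\<theta>. (\<integral>\<^sup>+a. ennreal \<bar>a\<bar> * G (a, a * tan \<theta>) \<partial>lborel) * ennreal (inverse ((cos \<theta>)\<^sup>2)) *
      indicator {- (pi / 2)<..<pi / 2} \<theta> \<partial>lborel)"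
    by (rule nn_integral_tan_substitution) measurable
  also have "\<dots> = (\<integral>\<^sup>+\<theta>. (\<integral>\<^sup>+s. ennreal \<bar>s\<bar> * G (s * cos \<theta>, s * sin \<theta>) \<partial>lborel) *
      indicator {- (pi / 2)<..<pi / 2} \<theta> \<partial>lborel)"
  proof (intro nn_integral_cong)
    fix \<theta> :: real
    show "(\<integral>\<^sup>+a. ennreal \<bar>a\<bar> * G (a, a * tan \<theta>) \<partial>lborel) * ennreal (inverse ((cos \<theta>)\<^sup>2)) *
        indicator {- (pi / 2)<..<pi / 2} \<theta> =
      (\<integral>\<^sup>+s. ennreal \<bar>s\<bar> * G (s * cos \<theta>, s * sin \<theta>) \<partial>lborel) * indicator {- (pi / 2)<..<pi / 2} \<theta>"
    proof (cases "\<theta> \<in> {- (pi / 2)<..<pi / 2}")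
      case True
      then have c: "cos \<theta> > 0" by (intro cos_gt_zero_pi) auto
      have "(\<integral>\<^sup>+a. ennreal \<bar>a\<bar> * G (a, a * tan \<theta>) \<partial>lborel) =
          ennreal (cos \<theta>) * (\<integral>\<^sup>+s. ennreal \<bar>cos \<theta> * s\<bar> * G (cos \<theta> * s, cos \<theta> * s * tan \<theta>) \<partial>lborel)"
        using c by (subst nn_integral_real_affine[where c = "cos \<theta>" and t = 0]) auto
      also have "(\<lambda>s. ennreal \<bar>cos \<theta> * s\<bar> * G (cos \<theta> * s, cos \<theta> * s * tan \<theta>)) =
          (\<lambda>s. ennreal (cos \<theta>) * (ennreal \<bar>s\<bar> * G (s * cos \<theta>, s * sin \<theta>)))"
        using c by (auto simp: fun_eq_iff abs_mult tan_def ennreal_mult mult_ac)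
      also have "ennreal (cos \<theta>) * (\<integral>\<^sup>+s. ennreal (cos \<theta>) * (ennreal \<bar>s\<bar> * G (s * cos \<theta>, s * sin \<theta>)) \<partial>lborel) =
          ennreal ((cos \<theta>)\<^sup>2) * (\<integral>\<^sup>+s. ennreal \<bar>s\<bar> * G (s * cos \<theta>, s * sin \<theta>) \<partial>lborel)"
        using c by (subst nn_integral_cmult) (auto simp: power2_eq_square ennreal_mult mult.assoc)
      finally have "(\<integral>\<^sup>+a. ennreal \<bar>a\<bar> * G (a, a * tan \<theta>) \<partial>lborel) * ennreal (inverse ((cos \<theta>)\<^sup>2)) =
          (ennreal ((cos \<theta>)\<^sup>2) * ennreal (inverse ((cos \<theta>)\<^sup>2))) * (\<integral>\<^sup>+s. ennreal \<bar>s\<bar> * G (s * cos \<theta>, s * sin \<theta>) \<partial>lborel)"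
        by (simp only: mult_ac)
      also have "ennreal ((cos \<theta>)\<^sup>2) * ennreal (inverse ((cos \<theta>)\<^sup>2)) = 1"
        using c by (simp flip: ennreal_mult)
      finally show ?thesis using True by simp
    qed simp
  qed
  finally show ?thesis .
qed

text \<open>The interval \<open>[0, 2 pi]\<close> is cut at \<open>pi / 2\<close> and \<open>3 pi / 2\<close>. The middle piece is a translate of the
half-period \<open>(- pi / 2, pi / 2)\<close> by \<open>pi\<close>; the last piece, translated by \<open>- 2 pi\<close>, completes the first
to another copy of it. The end points form a null set.\<close>

lemma nn_integral_antipodal_periodic:
  fixes H :: "real \<Rightarrow> ennreal"
  assumes [measurable]: "H \<in> borel_measurable borel" and H: "\<And>\<theta>. H (\<theta> + pi) = H \<theta>"
  shows "(\<integral>\<^sup>+\<theta>. H \<theta> * indicator {0..2 * pi} \<theta> \<partial>lborel) =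
    2 * (\<integral>\<^sup>+\<theta>. H \<theta> * indicator {- (pi / 2)<..<pi / 2} \<theta> \<partial>lborel)"
proof -
  let ?J = "\<lambda>A. \<integral>\<^sup>+\<theta>. H \<theta> * indicator A \<theta> \<partial>lborel"
  have H2: "H (\<theta> + 2 * pi) = H \<theta>" for \<theta>
  proof -
    have "\<theta> + 2 * pi = (\<theta> + pi) + pi" by simp
    then show ?thesis by (simp only: H)
  qed
  have ae: "?J A = ?J B" if "A - {0, 2 * pi, - (pi / 2)} = B - {0, 2 * pi, - (pi / 2)}" for A B
  proof (rule nn_integral_cong_AE)
    show "AE \<theta> in lborel. H \<theta> * indicator A \<theta> = H \<theta> * indicator B \<theta>"
      using AE_lborel_singleton[of "0::real"] AE_lborel_singleton[of "2 * pi"] AE_lborel_singleton[of "- (pi / 2)"]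
    proof eventually_elim
      fix \<theta> :: real assume "\<theta> \<noteq> 0" "\<theta> \<noteq> 2 * pi" "\<theta> \<noteq> - (pi / 2)"
      moreover have "\<theta> \<in> A - {0, 2 * pi, - (pi / 2)} \<longleftrightarrow> \<theta> \<in> B - {0, 2 * pi, - (pi / 2)}"
        unfolding that ..
      ultimately have "\<theta> \<in> A \<longleftrightarrow> \<theta> \<in> B" by simp
      then show "H \<theta> * indicator A \<theta> = H \<theta> * indicator B \<theta>" by (simp add: indicator_def)
    qed
  qed
  have add: "?J (A \<union> B) = ?J A + ?J B" if "A \<inter> B = {}" "A \<in> sets borel" "B \<in> sets borel" for A B
    using that by (subst nn_integral_add[symmetric]) (auto intro!: nn_integral_cong split: split_indicator)
  have shift: "?J {a..<b} = ?J {a - t..<b - t}" if "\<And>\<theta>. H (\<theta> + t) = H \<theta>" for a b t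
    by (subst nn_integral_real_affine[where c = 1 and t = t])
      (auto intro!: nn_integral_cong simp: that add.commute[of t] split: split_indicator)
  have "?J {0..2 * pi} = ?J ({0..<pi / 2} \<union> {pi / 2..<3 * pi / 2} \<union> {3 * pi / 2..<2 * pi})"
    by (rule ae) auto
  also have "\<dots> = ?J {0..<pi / 2} + ?J {pi / 2..<3 * pi / 2} + ?J {3 * pi / 2..<2 * pi}"
    by (subst add, force, simp, simp, subst add, force, simp, simp, rule refl)
  also have "?J {pi / 2..<3 * pi / 2} = ?J {- (pi / 2)..<pi / 2}"
    by (subst shift[of pi, OF H]) simp
  also have "?J {3 * pi / 2..<2 * pi} = ?J {- (pi / 2)..<0}"
    by (subst shift[of "2 * pi", OF H2]) simp
  also have "?J {0..<pi / 2} + ?J {- (pi / 2)..<pi / 2} + ?J {- (pi / 2)..<0} =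
      ?J ({- (pi / 2)..<0} \<union> {0..<pi / 2}) + ?J {- (pi / 2)..<pi / 2}"
    by (subst add) (auto simp: add_ac)
  also have "{- (pi / 2)..<0} \<union> {0..<pi / 2} = {- (pi / 2)..<pi / 2}"
    using pi_gt_zero by auto
  also have "?J {- (pi / 2)..<pi / 2} = ?J {- (pi / 2)<..<pi / 2}"
    by (rule ae) auto
  finally show ?thesis by (simp only: mult_2)
qed

lemma vector_2_eq: "vector [a, b] = a *\<^sub>R axis 1 1 + b *\<^sub>R (axis 2 1 :: real ^ 2)"
  by (simp add: vec_eq_iff forall_2 axis_def)

lemma omega_eq: "omega \<theta> = cos \<theta> *\<^sub>R axis 1 1 + sin \<theta> *\<^sub>R axis 2 1"
  by (simp add: omega_def vector_2_eq)

lemma borel_measurable_omega [measurable]: "omega \<in> borel_measurable borel"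
  unfolding omega_eq[abs_def] by measurable

text \<open>This carries integrals over \<^typ>\<open>real \<times> real\<close>, where Fubini's theorem applies, over to
\<^typ>\<open>real ^ 2\<close>.\<close>

lemma lborel_eq_distr_vector_2:
  "(lborel :: (real ^ 2) measure) = distr lborel borel (\<lambda>p. vector [fst p, snd p])"
proof (rule lborel_eqI)
  fix l u :: "real ^ 2" assume le: "\<And>b. b \<in> Basis \<Longrightarrow> l \<bullet> b \<le> u \<bullet> b"
  have B: "(Basis :: (real ^ 2) set) = {axis 1 1, axis 2 1}"
    by (auto simp: Basis_vec_def) (metis exhaust_2)+
  have [measurable]: "(\<lambda>p::real \<times> real. vector [fst p, snd p] :: real ^ 2) \<in> borel_measurable borel"
    unfolding vector_2_eq by (intro borel_measurable_continuous_onI continuous_intros)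
  have "(\<lambda>p::real \<times> real. vector [fst p, snd p]) -` box l u = box (l $ 1, l $ 2) (u $ 1, u $ 2)"
    by (auto simp: mem_box B Basis_prod_def inner_axis)
  then have "emeasure (distr lborel borel (\<lambda>p::real \<times> real. vector [fst p, snd p])) (box l u) =
      emeasure lborel (box (l $ 1, l $ 2) (u $ 1, u $ 2))"
    by (subst emeasure_distr) auto
  also have "\<dots> = (\<Prod>b\<in>Basis. (u - l) \<bullet> b)"
    using le[of "axis 1 1"] le[of "axis 2 1"]
    by (subst emeasure_lborel_box) (auto simp: B Basis_prod_def inner_axis axis_eq_axis mult.commute)
  finally show "emeasure (distr lborel borel (\<lambda>p::real \<times> real. vector [fst p, snd p])) (box l u) =
      (\<Prod>b\<in>Basis. (u - l) \<bullet> b)" .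
qed simp

text \<open>The factor 2 appears because \<open>(\<theta>, s)\<close> and \<open>(\<theta> + pi, - s)\<close> describe the same point, so the angles in
\<open>[0, 2 pi]\<close> cover the plane twice.\<close>

lemma nn_integral_polar:
  fixes G :: "real ^ 2 \<Rightarrow> ennreal"
  assumes [measurable]: "G \<in> borel_measurable borel"
  shows "(\<integral>\<^sup>+\<theta>. (\<integral>\<^sup>+s. ennreal \<bar>s\<bar> * G (s *\<^sub>R omega \<theta>) \<partial>lborel) * indicator {0..2 * pi} \<theta> \<partial>lborel) =
    2 * (\<integral>\<^sup>+\<xi>. G \<xi> \<partial>lborel)"
proof -
  let ?H = "\<lambda>\<theta>. \<integral>\<^sup>+s. ennreal \<bar>s\<bar> * G (s *\<^sub>R omega \<theta>) \<partial>lborel"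
  have [measurable]: "(\<lambda>p::real \<times> real. vector [fst p, snd p] :: real ^ 2) \<in> borel_measurable borel"
    unfolding vector_2_eq by (intro borel_measurable_continuous_onI continuous_intros)
  have GV: "(\<lambda>p::real \<times> real. G (vector [fst p, snd p])) \<in> borel_measurable borel" by measurable
  have "omega (\<theta> + pi) = - omega \<theta>" for \<theta>
    by (simp add: omega_eq)
  then have "?H (\<theta> + pi) = ?H \<theta>" for \<theta>
    by (subst nn_integral_real_affine[where c = "-1" and t = 0]) auto
  then have "(\<integral>\<^sup>+\<theta>. ?H \<theta> * indicator {0..2 * pi} \<theta> \<partial>lborel) =
      2 * (\<integral>\<^sup>+\<theta>. ?H \<theta> * indicator {- (pi / 2)<..<pi / 2} \<theta> \<partial>lborel)"
    by (intro nn_integral_antipodal_periodic) measurable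
  also have "(\<integral>\<^sup>+\<theta>. ?H \<theta> * indicator {- (pi / 2)<..<pi / 2} \<theta> \<partial>lborel) =
      (\<integral>\<^sup>+p. G (vector [fst p, snd p]) \<partial>lborel)"
    by (subst nn_integral_polar_half_plane[OF GV]) (simp add: omega_eq vector_2_eq scaleR_add_right)
  also have "\<dots> = (\<integral>\<^sup>+\<xi>. G \<xi> \<partial>lborel)"
    by (subst lborel_eq_distr_vector_2, subst nn_integral_distr) auto
  finally show ?thesis .
qed

text \<open>As an identity of measures, the polar coordinate formula transfers to integrals of vector-valued
functions together with their integrability.\<close>

lemma lborel_polar:
  "density (lborel :: (real ^ 2) measure) (\<lambda>_. ennreal 2) =
    distr (density (lborel \<Otimes>\<^sub>M lborel) (\<lambda>p. ennreal (\<bar>snd p\<bar> * indicator {0..2 * pi} (fst p)))) borel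
      (\<lambda>p. snd p *\<^sub>R omega (fst p))" (is "_ = distr (density _ ?w) _ ?P")
proof (rule measure_eqI)
  fix A :: "(real ^ 2) set" assume "A \<in> sets (density lborel (\<lambda>_. ennreal 2))"
  then have A [measurable]: "A \<in> sets borel" by simp
  have P [measurable]: "?P \<in> borel_measurable (lborel \<Otimes>\<^sub>M lborel)" by measurable
  have "emeasure (distr (density (lborel \<Otimes>\<^sub>M lborel) ?w) borel ?P) A =
      emeasure (density (lborel \<Otimes>\<^sub>M lborel) ?w) (?P -` A \<inter> space (lborel \<Otimes>\<^sub>M lborel))"
    by (subst emeasure_distr) auto
  also have "\<dots> = (\<integral>\<^sup>+p. ?w p * indicator (?P -` A \<inter> space (lborel \<Otimes>\<^sub>M lborel)) p \<partial>(lborel \<Otimes>\<^sub>M lborel))"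
    by (rule emeasure_density) (use measurable_sets[OF P A] in auto)
  also have "\<dots> = (\<integral>\<^sup>+p. ?w p * indicator A (?P p) \<partial>(lborel \<Otimes>\<^sub>M lborel))"
    by (intro nn_integral_cong) (auto split: split_indicator)
  also have "\<dots> = (\<integral>\<^sup>+\<theta>. \<integral>\<^sup>+s. ?w (\<theta>, s) * indicator A (?P (\<theta>, s)) \<partial>lborel \<partial>lborel)"
    by (rule lborel.nn_integral_fst[symmetric]) measurable
  also have "\<dots> = (\<integral>\<^sup>+\<theta>. (\<integral>\<^sup>+s. ennreal \<bar>s\<bar> * indicator A (s *\<^sub>R omega \<theta>) \<partial>lborel) * indicator {0..2 * pi} \<theta> \<partial>lborel)"
    by (auto intro!: nn_integral_cong split: split_indicator)
  also have "\<dots> = 2 * (\<integral>\<^sup>+\<xi>. indicator A \<xi> \<partial>lborel)"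
    by (rule nn_integral_polar) simp
  also have "\<dots> = emeasure (density lborel (\<lambda>_. ennreal 2)) A"
    by (simp add: emeasure_density nn_integral_cmult)
  finally show "emeasure (density lborel (\<lambda>_. ennreal 2)) A =
    emeasure (distr (density (lborel \<Otimes>\<^sub>M lborel) ?w) borel ?P) A" by simp
qed simp

theorem integral_polar:
  fixes h :: "real ^ 2 \<Rightarrow> 'b::{banach, second_countable_topology}"
  assumes h: "integrable lborel h"
  shows "(LINT \<theta>:{0..2 * pi}|lborel. (LINT s|lborel. \<bar>s\<bar> *\<^sub>R h (s *\<^sub>R omega \<theta>))) = 2 *\<^sub>R (LINT \<xi>|lborel. h \<xi>)"
proof -
  have [measurable]: "h \<in> borel_measurable borel" using borel_measurable_integrable[OF h] by simp
  let ?w = "\<lambda>p::real \<times> real. \<bar>snd p\<bar> * indicator {0..2 * pi} (fst p)"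
  let ?P = "\<lambda>p. snd p *\<^sub>R omega (fst p)"
  have "integrable (density lborel (\<lambda>_. ennreal 2)) h"
    by (subst integrable_density) (auto intro: h)
  then have i: "integrable (lborel \<Otimes>\<^sub>M lborel) (\<lambda>p. ?w p *\<^sub>R h (?P p))"
    unfolding lborel_polar by (simp add: integrable_distr_eq integrable_density)
  have "2 *\<^sub>R (LINT \<xi>|lborel. h \<xi>) = (LINT \<xi>|density lborel (\<lambda>_. ennreal 2). h \<xi>)"
    by (subst integral_density) auto
  also have "\<dots> = (LINT p|(lborel \<Otimes>\<^sub>M lborel). ?w p *\<^sub>R h (?P p))"
    unfolding lborel_polar by (simp add: integral_distr integral_density)
  also have "\<dots> = (LINT \<theta>|lborel. (LINT s|lborel. ?w (\<theta>, s) *\<^sub>R h (?P (\<theta>, s))))"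
    by (rule lborel_pair.integral_fst'[OF i, symmetric])
  also have "\<dots> = (LINT \<theta>:{0..2 * pi}|lborel. (LINT s|lborel. \<bar>s\<bar> *\<^sub>R h (s *\<^sub>R omega \<theta>)))"
    unfolding set_lebesgue_integral_def
    by (intro Bochner_Integration.integral_cong refl) (auto split: split_indicator)
  finally show ?thesis by simp
qed

section \<open>The Fourier slice theorem and the inversion formula\<close>

text \<open>Evenness turns the integral against \<open>\<phi> (x \<bullet> omega \<theta> - p)\<close> into a convolution with \<open>\<phi>\<close>, and the
absence of zeros of the Fourier transform allows the division in the modified Riesz potential.\<close>

lemma Omega_facts:
  assumes "\<phi> \<in> Omega"
  shows Omega_integrable: "integrable lborel \<phi>"
    and Omega_even: "\<phi> (- t) = \<phi> t"
    and Omega_fourier1_nonzero: "fourier1 (\<lambda>t. complex_of_real (\<phi> t)) s \<noteq> 0"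
proof -
  show "integrable lborel \<phi>"
    using assms by (simp add: Omega_def symmetric_mollifier_def positive_mollifier_def)
  obtain g where "\<And>t. \<phi> t = g \<bar>t\<bar>"
    using assms by (auto simp: Omega_def symmetric_mollifier_def)
  then show "\<phi> (- t) = \<phi> t" by simp
  have "Re (fourier1 (\<lambda>t. complex_of_real (\<phi> t)) s) > 0"
    using assms by (simp add: Omega_def)
  then show "fourier1 (\<lambda>t. complex_of_real (\<phi> t)) s \<noteq> 0" by auto
qed

lemma fourier1_cis: "fourier1 g s = (LINT t|lborel. g t * cis (- (s * t))) / sqrt (2 * pi)"
  by (simp add: fourier1_def cis_conv_exp mult.assoc)

text \<open>The Fourier slice theorem for the smoothed transform. As a function of \<open>p\<close>, the modified Radon
transform is the convolution of the ordinary Radon transform of \<open>f\<close> with the even function \<open>\<phi>\<close>; its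
Fourier transform is therefore that of \<open>\<phi>\<close> times the two-dimensional transform of \<open>f\<close>
on the line through \<open>omega \<theta>\<close>. Integrating first over \<open>p\<close> shows this in one step, without the
Radon transform itself.\<close>

lemma fourier1_modified_radon:
  fixes \<phi> :: "real \<Rightarrow> real" and f :: "real ^ 2 \<Rightarrow> complex"
  assumes \<phi>: "integrable lborel \<phi>" "\<And>t. \<phi> (- t) = \<phi> t" and f: "integrable lborel f"
  shows "fourier1 (modified_radon \<phi> f \<theta>) s =
    fourier1 (\<lambda>t. complex_of_real (\<phi> t)) s * fourier_integral f (s *\<^sub>R omega \<theta>)"
proof -
  have [measurable]: "\<phi> \<in> borel_measurable borel" "f \<in> borel_measurable borel"
    using borel_measurable_integrable[OF \<phi>(1)] borel_measurable_integrable[OF f] by simp_all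
  let ?k = "\<lambda>y p. complex_of_real (\<phi> (y \<bullet> omega \<theta> - p)) * f y * cis (- (s * p))"
  let ?c = "LINT u|lborel. complex_of_real (\<phi> u) * cis (- (s * u))"
  have p: "integrable lborel (\<lambda>p. complex_of_real (\<phi> (a - p)))" for a
  proof -
    have "integrable lborel (\<lambda>p. \<phi> (a + - 1 * p))"
      by (rule lborel_integrable_real_affine[OF \<phi>(1)]) simp
    then show ?thesis by (intro integrable_of_real) simp
  qed
  have n: "(LINT p|lborel. \<bar>\<phi> (a - p)\<bar>) = (LINT u|lborel. \<bar>\<phi> u\<bar>)" for a
    using lborel_integral_real_affine[of "-1" "\<lambda>u. \<bar>\<phi> u\<bar>" a] by simp
  have i: "integrable (lborel \<Otimes>\<^sub>M lborel) (case_prod ?k)"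
  proof (rule lborel_pair.Fubini_integrable)
    have "(LINT p|lborel. norm (?k y p)) = norm (f y) * (LINT u|lborel. \<bar>\<phi> u\<bar>)" for y
      by (simp add: norm_mult n mult.commute)
    then show "integrable lborel (\<lambda>y. LINT p|lborel. norm (case_prod ?k (y, p)))"
      by (simp add: integrable_norm f)
    show "AE y in lborel. integrable lborel (\<lambda>p. case_prod ?k (y, p))"
      by (intro AE_I2) (auto intro!: integrable_mult_cis integrable_mult_left p)
  qed measurable
  have inner: "(LINT p|lborel. ?k y p) = ?c * (f y * cis (- (y \<bullet> (s *\<^sub>R omega \<theta>))))" for y
  proof -
    have "(LINT p|lborel. ?k y p) = (LINT u|lborel. ?k y (y \<bullet> omega \<theta> + u))"
      using lborel_integral_real_affine[of 1 "?k y" "y \<bullet> omega \<theta>"] by simp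
    also have "\<dots> = (LINT u|lborel. complex_of_real (\<phi> u) * cis (- (s * u)) * (f y * cis (- (y \<bullet> (s *\<^sub>R omega \<theta>)))))"
    proof (intro Bochner_Integration.integral_cong refl)
      fix u
      have "cis (- (s * (y \<bullet> omega \<theta> + u))) = cis (- (s * u)) * cis (- (y \<bullet> (s *\<^sub>R omega \<theta>)))"
        by (simp add: cis_mult algebra_simps)
      then show "?k y (y \<bullet> omega \<theta> + u) =
          complex_of_real (\<phi> u) * cis (- (s * u)) * (f y * cis (- (y \<bullet> (s *\<^sub>R omega \<theta>))))"
        by (simp add: \<phi>(2))
    qed
    also have "\<dots> = ?c * (f y * cis (- (y \<bullet> (s *\<^sub>R omega \<theta>))))"
      by (rule integral_mult_left_zero)
    finally show ?thesis .
  qed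
  have "(LINT p|lborel. modified_radon \<phi> f \<theta> p * cis (- (s * p))) = (LINT p|lborel. (LINT y|lborel. ?k y p))"
    unfolding modified_radon_def radon_kernel_def
    by (intro Bochner_Integration.integral_cong refl integral_mult_left_zero[symmetric])
  also have "\<dots> = (LINT y|lborel. (LINT p|lborel. ?k y p))"
    by (rule lborel_pair.Fubini_integral[OF i])
  also have "\<dots> = ?c * fourier_integral f (s *\<^sub>R omega \<theta>)"
    unfolding inner fourier_integral_def by (rule integral_mult_right_zero)
  finally show ?thesis by (simp add: fourier1_cis)
qed

text \<open>Dividing by the transform of \<open>\<phi>\<close> undoes the smoothing exactly, so what remains does not depend on
\<open>\<phi>\<close>.\<close>

lemma modified_riesz_modified_radon:
  assumes "\<phi> \<in> Omega" "integrable lborel f"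
  shows "modified_riesz \<phi> (modified_radon \<phi> f) \<theta> t =
    (LINT s|lborel. \<bar>s\<bar> *\<^sub>R (fourier_integral f (s *\<^sub>R omega \<theta>) * cis (s * t))) / (2 * pi)"
proof -
  have "fourier1 (modified_radon \<phi> f \<theta>) s / fourier1 (\<lambda>t. complex_of_real (\<phi> t)) s =
      fourier_integral f (s *\<^sub>R omega \<theta>)" for s
    using fourier1_modified_radon[OF Omega_integrable[OF assms(1)] Omega_even[OF assms(1)] assms(2), of \<theta> s]
      Omega_fourier1_nonzero[OF assms(1), of s]
    by simp
  then show ?thesis
    by (simp add: modified_riesz_def inv_fourier1_def cis_conv_exp scaleR_conv_of_real mult.assoc flip: of_real_mult)
qed

theorem theorem3p5:
  fixes \<phi> :: "real \<Rightarrow> real" and f :: "real ^ 2 \<Rightarrow> complex" and x :: "real ^ 2"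
  assumes "\<phi> \<in> Omega"
    and "smooth f" and "compactly_supported f"
  shows "f x = 1 / (4 * pi) * dual_radon (modified_riesz \<phi> (modified_radon \<phi> f)) x"
proof -
  have fc: "continuous_on UNIV f" using assms(2) by (rule smooth_continuous)
  have fi: "integrable lborel f"
    by (rule integrable_continuous_compactly_supported[OF fc assms(3)])
  obtain B where B: "\<And>y. norm (f y) \<le> B"
    using bounded_continuous_compactly_supported[OF fc assms(3)] by blast
  have Fi: "integrable lborel (fourier_integral f)"
    by (rule integrable_fourier_integral[OF assms(2,3)])
  \<comment> \<open>On the line \<open>\<xi> = s *\<^sub>R omega \<theta>\<close> the phase \<open>\<xi> \<bullet> x\<close> is \<open>s * (x \<bullet> omega \<theta>)\<close>, so the filtered
    back-projection is the polar form of the Fourier inversion integral with integrand \<open>?h\<close>.\<close>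
  let ?h = "\<lambda>\<xi>. fourier_integral f \<xi> * cis (\<xi> \<bullet> x)"
  have hi: "integrable lborel ?h" by (rule integrable_mult_cis[OF Fi]) measurable
  have "dual_radon (modified_riesz \<phi> (modified_radon \<phi> f)) x =
      (LINT \<theta>:{0..2 * pi}|lborel. (LINT s|lborel. \<bar>s\<bar> *\<^sub>R ?h (s *\<^sub>R omega \<theta>)) / (2 * pi))"
    unfolding dual_radon_def modified_riesz_modified_radon[OF assms(1) fi]
    by (simp add: inner_commute)
  also have "\<dots> = (LINT \<theta>:{0..2 * pi}|lborel. (LINT s|lborel. \<bar>s\<bar> *\<^sub>R ?h (s *\<^sub>R omega \<theta>))) / (2 * pi)"
    by (rule set_integral_divide_zero)
  also have "\<dots> = 2 *\<^sub>R (LINT \<xi>|lborel. ?h \<xi>) / (2 * pi)"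
    by (simp only: integral_polar[OF hi])
  also have "(LINT \<xi>|lborel. ?h \<xi>) = (2 * pi) ^ 2 * f x"
    using fourier_inversion[OF fi fc B Fi, of x] by simp
  also have "2 *\<^sub>R (complex_of_real ((2 * pi) ^ 2) * f x) / (2 * pi) = 4 * pi * f x"
    by (simp add: scaleR_conv_of_real power2_eq_square)
  finally show ?thesis by simp
qed

end
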